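(* Let $f:[0,1]\to[0,1]$ be the dyadic map, $f(x)=2x$ if $0\le x<\frac12$ and $f(x)=2x-1$ if $\frac12\le x\le1$, and let $d(x,y)=|x-y|$ be the Euclidean metric on $[0,1]$. Then the discrete dynamical system $([0,1],d,f)$ is topologically mixing.
   Context: A discrete dynamical system $(X,d,f)$ consists of a set $X$, a metric $d$ on $X$, and a function $f:X\to X$ (not assumed continuous). It is topologically mixing if and only if for every pair of nonempty open sets $U,V$ of $(X,d)$ there is an integer $n\ge 0$ such that $f^N(U)\cap V\neq\emptyset$ for all integers $N\ge n$. *)

theory Defs
  imports "HOL-Analysis.Analysis"
begin

locale discrete_dynamical_system = Metric_space X d
  for X :: "'a set" and d :: "'a \<Rightarrow> 'a \<Rightarrow> real" +
  fixes f :: "'a \<Rightarrow> 'a"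
  assumes self_map: "f \<in> X \<rightarrow> X"
begin

definition topologically_mixing :: bool where
  "topologically_mixing \<longleftrightarrow>
     (\<forall>U V. openin mtopology U \<and> U \<noteq> {} \<and> openin mtopology V \<and> V \<noteq> {} \<longrightarrow>
       (\<exists>n::nat. \<forall>N\<ge>n. (f ^^ N) ` U \<inter> V \<noteq> {}))"

end

text \<open>Only the values on the unit interval matter; outside it the map is the obvious extension.\<close>

definition dyadic_map :: "real \<Rightarrow> real" where
  "dyadic_map x = (if x < 1/2 then 2 * x else 2 * x - 1)"

end

(* An integer k < 2^N and a target y in [0,1) give the point (k + y) / 2^N, which f^N sends to y.
   These points are 2^-N dense in [0,1], so f^N maps every ball of radius above 2^-N onto
   a set containing [0,1). *)
theory Submission
  imports Defs
begin

text \<open>Write \<open>k\<close> with \<open>N\<close> binary digits. Each application of the map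
  deletes the leading digit and leaves the fractional part \<open>y\<close> alone, so after
  \<open>N\<close> applications only \<open>y\<close> remains. The induction peels off the
  application made first; \<open>k\<close> is arbitrary because deleting a digit 1 changes
  it.\<close>

lemma dyadic_map_funpow_branch:
  fixes y :: real and k N :: nat
  assumes "0 \<le> y" "y < 1" "k < 2 ^ N"
  shows "(dyadic_map ^^ N) ((real k + y) / 2 ^ N) = y"
  using assms(3)
proof (induction N arbitrary: k)
  case 0
  then show ?case by simp
next
  case (Suc N)
  show ?case
  proof (cases "k < 2 ^ N")
    case True
    \<comment> \<open>Leading digit 0: integrality leaves a gap of 1 above \<open>k\<close>, and
      \<open>y < 1\<close> then puts the point strictly below 1/2, on the doubling branch.\<close>
    then have "real (k + 1) \<le> real (2 ^ N)" by (intro of_nat_mono) simp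
    then have "real k + 1 \<le> 2 ^ N" by simp
    then have "dyadic_map ((real k + y) / 2 ^ Suc N) = (real k + y) / 2 ^ N"
      using assms by (simp add: dyadic_map_def field_simps)
    then show ?thesis
      using Suc.IH[OF True] by (simp add: funpow_Suc_right del: funpow.simps power_Suc)
  next
    case False
    then have "real (2 ^ N) \<le> real k" by (intro of_nat_mono) simp
    then have "2 ^ N \<le> real k + y" using assms(1) by (simp only: of_nat_power of_nat_numeral)
    then have "\<not> (real k + y) / 2 ^ Suc N < 1 / 2"
      by (simp add: field_simps)
    \<comment> \<open>Leading digit 1: the \<open>- 1\<close> of the right branch becomes
      \<open>- 2 ^ N\<close> in the numerator.\<close>
    then have "dyadic_map ((real k + y) / 2 ^ Suc N) = (real (k - 2 ^ N) + y) / 2 ^ N"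
      using False by (simp add: dyadic_map_def field_simps of_nat_diff)
    moreover have "k - 2 ^ N < 2 ^ N" using Suc.prems False by simp
    ultimately show ?thesis
      using Suc.IH by (simp add: funpow_Suc_right del: funpow.simps power_Suc)
  qed
qed

interpretation unit_interval: Metric_space "{0..1::real}" "\<lambda>x y. \<bar>x - y\<bar>"
  by unfold_locales auto

interpretation dyadic: discrete_dynamical_system "{0..1::real}" "\<lambda>x y. \<bar>x - y\<bar>" dyadic_map
  by unfold_locales (auto simp: dyadic_map_def)

text \<open>The point 1 is not isolated, so an open set containing it also contains points below it.
  Staying below 1 matters twice later: the target \<open>y\<close> must be a fractional part, and
  \<open>u < 1\<close> makes the index of its dyadic interval less than
  \<open>2 ^ N\<close>.\<close>

lemma open_unit_interval_ball_below_1: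
  assumes "openin unit_interval.mtopology U" "U \<noteq> {}"
  obtains u e where "0 \<le> u" "u < 1" "u \<in> U" "0 < e"
    "\<And>x. \<lbrakk>0 \<le> x; x \<le> 1; \<bar>u - x\<bar> < e\<rbrakk> \<Longrightarrow> x \<in> U"
proof -
  have sub: "U \<subseteq> {0..1}"
    and ball: "\<And>x. x \<in> U \<Longrightarrow> \<exists>r>0. unit_interval.mball x r \<subseteq> U"
    using assms(1) unfolding unit_interval.openin_mtopology by blast+
  have nbhd: "\<exists>r>0. \<forall>x. 0 \<le> x \<and> x \<le> 1 \<and> \<bar>w - x\<bar> < r \<longrightarrow> x \<in> U" if "w \<in> U" for w
    using ball[OF that] sub that by (force simp: unit_interval.mball_def)
  obtain w where w: "w \<in> U" using assms(2) by blast
  obtain r where r: "r > 0" "\<And>x. 0 \<le> x \<Longrightarrow> x \<le> 1 \<Longrightarrow> \<bar>w - x\<bar> < r \<Longrightarrow> x \<in> U"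
    using nbhd[OF w] by blast
  have "\<exists>u\<in>U. 0 \<le> u \<and> u < 1"
  proof (cases "w < 1")
    case True
    then show ?thesis using w sub by force
  next
    case False
    then have "w = 1" using w sub by force
    \<comment> \<open>The maximum with 0 keeps the witness in the unit interval when
      \<open>r\<close> exceeds 2.\<close>
    then have "max 0 (1 - r / 2) \<in> U" using r(1) by (intro r(2)) auto
    then show ?thesis using r(1) by (intro bexI[of _ "max 0 (1 - r / 2)"]) auto
  qed
  then show ?thesis using nbhd that by metis
qed

theorem mainTheorem7:
  shows "discrete_dynamical_system {0..1::real} (\<lambda>x y. \<bar>x - y\<bar>) dyadic_map \<and>
         discrete_dynamical_system.topologically_mixing {0..1::real} (\<lambda>x y. \<bar>x - y\<bar>) dyadic_map"
proof
  show "discrete_dynamical_system {0..1::real} (\<lambda>x y. \<bar>x - y\<bar>) dyadic_map"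
    by (rule dyadic.discrete_dynamical_system_axioms)
  show "dyadic.topologically_mixing"
    unfolding dyadic.topologically_mixing_def
  proof (intro allI impI, elim conjE)
    fix U V
    assume U: "openin unit_interval.mtopology U" "U \<noteq> {}"
      and V: "openin unit_interval.mtopology V" "V \<noteq> {}"
    obtain u e where u: "0 \<le> u" "u < 1" "0 < e"
      and ball: "\<And>x. \<lbrakk>0 \<le> x; x \<le> 1; \<bar>u - x\<bar> < e\<rbrakk> \<Longrightarrow> x \<in> U"
      using open_unit_interval_ball_below_1[OF U] by metis
    obtain y where y: "0 \<le> y" "y < 1" "y \<in> V"
      using open_unit_interval_ball_below_1[OF V] by metis
    obtain n where n: "(1 / 2) ^ n < e"
      using real_arch_pow_inv[OF u(3), of "1/2"] by auto
    have "(dyadic_map ^^ N) ` U \<inter> V \<noteq> {}" if "n \<le> N" for N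
    proof -
      have "(1 / 2 :: real) ^ N \<le> (1 / 2) ^ n"
        using that by (intro power_decreasing) auto
      then have small: "1 / 2 ^ N < e" using n by (simp add: power_one_over)
      \<comment> \<open>\<open>k\<close> is the index of the dyadic interval of length
        \<open>1 / 2 ^ N\<close> that contains \<open>u\<close>; the preimage \<open>x\<close> of
        \<open>y\<close> is taken in that same interval.\<close>
      define k where "k = nat \<lfloor>2 ^ N * u\<rfloor>"
      have k: "real k \<le> 2 ^ N * u" "2 ^ N * u < real k + 1"
        unfolding k_def using u(1) by (auto simp: of_nat_nat)
      have "real k < 2 ^ N"
        using k(1) u(2) by (smt (verit) mult_less_cancel_left2 zero_less_power)
      then have "k < 2 ^ N" by simp
      define x where "x = (real k + y) / 2 ^ N"
      have fx: "(dyadic_map ^^ N) x = y"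
        unfolding x_def by (rule dyadic_map_funpow_branch) fact+
      have "real (k + 1) \<le> real (2 ^ N)" using \<open>k < 2 ^ N\<close> by (intro of_nat_mono) simp
      then have "0 \<le> x" "x \<le> 1" using y by (auto simp: x_def field_simps)
      moreover have "\<bar>u - x\<bar> < e"
      proof -
        have "u - x = (2 ^ N * u - (real k + y)) / 2 ^ N" by (simp add: x_def field_simps)
        \<comment> \<open>Both \<open>2 ^ N * u\<close> and \<open>real k + y\<close> lie between
          \<open>k\<close> and \<open>k + 1\<close>.\<close>
        also have "\<bar>\<dots>\<bar> \<le> 1 / 2 ^ N"
          using k y by (simp add: abs_divide divide_right_mono)
        finally show ?thesis using small by simp
      qed
      ultimately have "x \<in> U" by (rule ball)
      then show ?thesis using fx y(3) by blast
    qed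
    then show "\<exists>n. \<forall>N\<ge>n. (dyadic_map ^^ N) ` U \<inter> V \<noteq> {}" by blast
  qed
qed

end
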